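(* For an odd prime $p$ let $Q_p(z)=\sum_{k=1}^{p-1}\left(\frac{k}{p}\right)z^k$ be the Fekete polynomial, where $\left(\frac{\cdot}{p}\right)$ is the Legendre symbol. Then, for every real number $\alpha\ge 0$, the sequence of $L^2$-normalized Fekete polynomials $\left(Q_p/\|Q_p\|_2\right)_p$, indexed by the odd primes $p$, is not $L^\alpha$-flat.
   Context: $S^1$ is the unit circle in $\mathbb{C}$ with normalized Lebesgue measure $dz$. For $\alpha>0$, $\|f\|_\alpha = \left(\int_{S^1}|f|^\alpha\,dz\right)^{1/\alpha}$, and $\|f\|_0=M(f)=\exp\left(\int_{S^1}\log|f|\,dz\right)$ is the Mahler measure. A sequence $(p_n)$ of analytic trigonometric polynomials (polynomials in $z$ restricted to $S^1$) with $\|p_n\|_2=1$ is called $L^\alpha$-flat, for $\alpha>0$, if $\big\||p_n|-1\big\|_\alpha\to 0$ as $n\to\infty$; it is called $L^0$-flat if $M(p_n)\to 1$. For a sequence indexed by primes, the limit is taken as $p\to\infty$ along the primes. *)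

theory Defs
  imports "HOL-Analysis.Analysis" "HOL-Number_Theory.Number_Theory"
    "HOL-Computational_Algebra.Polynomial"
begin

text \<open>Normalized Lebesgue measure on the unit circle, as a Borel measure on the complex
  plane that is concentrated on the circle.\<close>

definition circle_measure :: "complex measure" where
  "circle_measure = distr (uniform_measure lborel {0..<2 * pi}) borel cis"

definition mahler :: "(complex \<Rightarrow> 'a::real_normed_vector) \<Rightarrow> real" where
  "mahler f = exp (\<integral>z. ln (norm (f z)) \<partial>circle_measure)"

text \<open>Exponent 0 stands for the Mahler measure. The value is the intended one for nonzero
  polynomials, whose zeros on the circle form a null set and for which
  \<open>ln (norm (f z))\<close> is integrable. For a function that vanishes on a set of positive measure
  it is not, because of the convention \<open>ln 0 = 0\<close>.\<close>

definition L_norm :: "real \<Rightarrow> (complex \<Rightarrow> 'a::real_normed_vector) \<Rightarrow> real" where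
  "L_norm \<alpha> f =
     (if \<alpha> = 0 then mahler f
      else (\<integral>z. norm (f z) powr \<alpha> \<partial>circle_measure) powr (1 / \<alpha>))"

text \<open>The filter \<open>F\<close> on the index type says along which indices the limit is taken. The notion
  is meant for families with \<open>L_norm 2 (poly (q n)) = 1\<close>. This is deliberately not a conjunct,
  so that negating flatness only negates the convergence.\<close>

definition L_flat :: "real \<Rightarrow> 'i filter \<Rightarrow> ('i \<Rightarrow> complex poly) \<Rightarrow> bool" where
  "L_flat \<alpha> F q \<longleftrightarrow>
     (if \<alpha> = 0 then ((\<lambda>n. L_norm 0 (poly (q n))) \<longlongrightarrow> 1) F
      else ((\<lambda>n. L_norm \<alpha> (\<lambda>z. norm (poly (q n) z) - 1)) \<longlongrightarrow> 0) F)"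

definition fekete :: "nat \<Rightarrow> complex poly" where
  "fekete p = (\<Sum>k = 1..p - 1. Polynomial.monom (of_int (Legendre (int k) (int p))) k)"

definition normalized_fekete :: "nat \<Rightarrow> complex poly" where
  "normalized_fekete p = Polynomial.smult (complex_of_real (1 / L_norm 2 (poly (fekete p)))) (fekete p)"

definition along_odd_primes :: "nat filter" where
  "along_odd_primes = inf at_top (principal {p. prime p \<and> odd p})"

end

theory Submission
  imports Defs "HOL-Probability.Probability_Measure"
    "HOL-Computational_Algebra.Fundamental_Theorem_Algebra"
begin

text \<open>
  The normalized Fekete polynomial \<open>q\<close> of a prime \<open>p\<close> has so many zeros on the circle that it is
  small on a set of measure bounded below independently of \<open>p\<close>. This rules out flatness for all
  exponents at once.

  \<^emph>\<open>Zeros.\<close> The Legendre symbol \<open>\<chi>\<close> has \<open>\<chi>(p - k) = \<chi>(-1) \<chi>(k)\<close>, so the function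
  \<open>H(t) = cis(-pt/2) Q(cis t)\<close>, with \<open>Q\<close> the Fekete polynomial, is real or purely imaginary throughout.
  By multiplicativity of \<open>\<chi>\<close> its value at \<open>2\<pi>j/p\<close> is \<open>(-1)\<^sup>j \<chi>(j)\<close> times a constant, so \<open>H\<close>
  changes sign between \<open>2\<pi>j/p\<close> and \<open>2\<pi>(j+1)/p\<close> whenever \<open>\<chi>(j) = \<chi>(j+1)\<close>
  (\<open>fekete_zero_between\<close>). At least about a quarter of all \<open>j\<close> qualify
  (\<open>card_equal_consecutive_Legendre\<close>).

  \<^emph>\<open>Zeros force small values.\<close> Parseval gives \<open>\<parallel>q'\<parallel>\<^sub>2 \<le> p \<parallel>q\<parallel>\<^sub>2\<close>. So on most arcs of length
  \<open>2\<pi>/p\<close> the mean square of \<open>q'\<close> is of order at most \<open>p\<^sup>2\<close>. By Cauchy-Schwarz, \<open>q\<close> then stays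
  below \<open>1/2\<close> up to a distance of order \<open>1/p\<close> from a zero in such an arc. A positive proportion of the
  \<open>p\<close> arcs is concerned, which gives a set \<open>{|q| \<le> 1/2}\<close> of measure bounded below
  (\<open>measure_small_values\<close>).

  \<^emph>\<open>Small values exclude flatness\<close> (\<open>not_L_flat_if_small_values\<close>). For \<open>\<alpha> > 0\<close> the function
  \<open>||q| - 1|\<close> is at least \<open>1/2\<close> on this set. For \<open>\<alpha> = 0\<close> one integrates
  \<open>ln |q| \<le> (|q|\<^sup>2 - 1) / 2\<close>, whose right-hand side has mean \<open>0\<close> and which can be improved by a
  constant on the set, so the Mahler measure stays away from \<open>1\<close>. This last step needs
  \<open>ln |q|\<close> to be integrable, which is proved by splitting \<open>q\<close> into linear factors.
\<close>

section \<open>Integration over the circle\<close>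

lemma borel_measurable_cis [measurable]: "cis \<in> borel_measurable borel"
  by (intro borel_measurable_continuous_onI continuous_intros)

text \<open>The closed parameter interval is the one for which integrals of continuous functions have the
  fundamental theorem of calculus available.\<close>

lemma circle_measure_eq_density:
  "circle_measure = distr (density lborel (\<lambda>t. ennreal (indicator {0..2 * pi} t / (2 * pi)))) borel cis"
proof -
  have "emeasure lborel {0..<2 * pi} = ennreal (2 * pi)"
    using emeasure_lborel_Ico[of 0 "2 * pi"] by simp
  then have "uniform_measure lborel {0..<2 * pi}
      = density lborel (\<lambda>t. ennreal (indicator {0..<2 * pi} t / (2 * pi)))"
    unfolding uniform_measure_def
    by (auto intro!: density_cong AE_I2 split: split_indicator simp: divide_ennreal[symmetric])
  also have "\<dots> = density lborel (\<lambda>t. ennreal (indicator {0..2 * pi} t / (2 * pi)))"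
    by (rule density_cong, measurable)
       (use AE_lborel_singleton[of "2 * pi"] in \<open>auto elim!: eventually_mono split: split_indicator\<close>)
  finally show ?thesis
    unfolding circle_measure_def by simp
qed

lemma sets_circle_measure [simp, measurable_cong]: "sets circle_measure = sets borel"
  and space_circle_measure [simp]: "space circle_measure = UNIV"
  by (simp_all add: circle_measure_def)

lemma
  fixes f :: "complex \<Rightarrow> 'b::{banach, second_countable_topology}"
  assumes [measurable]: "f \<in> borel_measurable borel"
  shows integrable_circle_iff:
      "integrable circle_measure f \<longleftrightarrow> set_integrable lborel {0..2 * pi} (\<lambda>t. f (cis t))"
    and integral_circle_eq_LINT:
      "(\<integral>z. f z \<partial>circle_measure) = (LINT t:{0..2 * pi}|lborel. f (cis t)) /\<^sub>R (2 * pi)"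
proof -
  let ?d = "\<lambda>t::real. indicator {0..2 * pi} t / (2 * pi) :: real"
  have eq: "?d t *\<^sub>R f (cis t) = (1 / (2 * pi)) *\<^sub>R (indicator {0..2 * pi} t *\<^sub>R f (cis t))" for t
    by (simp split: split_indicator)
  have m: "(\<lambda>t. f (cis t)) \<in> borel_measurable lborel"
    by measurable
  have "integrable circle_measure f \<longleftrightarrow> integrable (density lborel (\<lambda>t. ennreal (?d t))) (\<lambda>t. f (cis t))"
    unfolding circle_measure_eq_density by (rule integrable_distr_eq) measurable
  also have "\<dots> \<longleftrightarrow> integrable lborel (\<lambda>t. ?d t *\<^sub>R f (cis t))"
    by (rule integrable_density[OF m]) auto
  also have "\<dots> \<longleftrightarrow> set_integrable lborel {0..2 * pi} (\<lambda>t. f (cis t))"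
    unfolding eq set_integrable_def
  proof
    let ?g = "\<lambda>t. indicator {0..2 * pi} t *\<^sub>R f (cis t)"
    assume "integrable lborel (\<lambda>t. (1 / (2 * pi)) *\<^sub>R ?g t)"
    then have "integrable lborel (\<lambda>t. (2 * pi) *\<^sub>R (1 / (2 * pi)) *\<^sub>R ?g t)"
      by (rule integrable_scaleR_right)
    then show "integrable lborel ?g"
      by simp
  qed (rule integrable_scaleR_right)
  finally show "integrable circle_measure f \<longleftrightarrow> set_integrable lborel {0..2 * pi} (\<lambda>t. f (cis t))" .
  have "(\<integral>z. f z \<partial>circle_measure) = (\<integral>t. f (cis t) \<partial>density lborel (\<lambda>t. ennreal (?d t)))"
    unfolding circle_measure_eq_density by (rule integral_distr) measurable
  also have "\<dots> = (\<integral>t. ?d t *\<^sub>R f (cis t) \<partial>lborel)"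
    by (rule integral_density[OF m]) auto
  also have "\<dots> = (LINT t:{0..2 * pi}|lborel. f (cis t)) /\<^sub>R (2 * pi)"
    unfolding eq set_lebesgue_integral_def integral_scaleR_right by (simp only: inverse_eq_divide)
  finally show "(\<integral>z. f z \<partial>circle_measure) = (LINT t:{0..2 * pi}|lborel. f (cis t)) /\<^sub>R (2 * pi)" .
qed

lemma
  fixes f :: "complex \<Rightarrow> 'b::euclidean_space"
  assumes f: "continuous_on UNIV f"
  shows integrable_circle_continuous: "integrable circle_measure f"
    and integral_circle_continuous:
      "(\<integral>z. f z \<partial>circle_measure) = integral {0..2 * pi} (\<lambda>t. f (cis t)) /\<^sub>R (2 * pi)"
proof -
  have m: "f \<in> borel_measurable borel"
    using f by (rule borel_measurable_continuous_onI)
  have s: "set_integrable lborel {0..2 * pi} (\<lambda>t. f (cis t))"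
    by (intro borel_integrable_atLeastAtMost' continuous_on_compose2[OF f] continuous_intros) auto
  show "integrable circle_measure f"
    using s by (simp add: integrable_circle_iff[OF m])
  show "(\<integral>z. f z \<partial>circle_measure) = integral {0..2 * pi} (\<lambda>t. f (cis t)) /\<^sub>R (2 * pi)"
    by (simp add: integral_circle_eq_LINT[OF m] set_borel_integral_eq_integral(2)[OF s])
qed

lemma prob_space_circle_measure: "prob_space circle_measure"
proof -
  have e: "emeasure lborel {0..<2 * pi} = ennreal (2 * pi)"
    using emeasure_lborel_Ico[of 0 "2 * pi"] by simp
  have "prob_space (uniform_measure lborel {0..<2 * pi})"
    by (rule prob_space_uniform_measure; subst e; simp)
  then show ?thesis
    unfolding circle_measure_def by (rule prob_space.prob_space_distr) measurable
qed

lemma measure_circle_eq: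
  assumes [measurable]: "A \<in> sets borel"
  shows "measure circle_measure A = measure lborel {t \<in> {0..2 * pi}. cis t \<in> A} / (2 * pi)"
proof -
  have "measure circle_measure A = (\<integral>z. indicator A z \<partial>circle_measure)"
    by (simp only: Bochner_Integration.integral_indicator space_circle_measure Int_UNIV_right)
  also have "\<dots> = (LINT t:{0..2 * pi}|lborel. indicator A (cis t)) / (2 * pi)"
    by (simp only: integral_circle_eq_LINT borel_measurable_indicator assms real_scaleR_def divide_inverse_commute)
  also have "(LINT t:{0..2 * pi}|lborel. indicator A (cis t)) =
      (\<integral>t. indicator {t \<in> {0..2 * pi}. cis t \<in> A} t \<partial>lborel)"
    unfolding set_lebesgue_integral_def
    by (rule Bochner_Integration.integral_cong) (simp_all add: indicator_def)
  also have "\<dots> = measure lborel {t \<in> {0..2 * pi}. cis t \<in> A}"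
    by simp
  finally show ?thesis .
qed

text \<open>\<open>cis\<close> is not injective on the closed parameter interval, but each point of the circle has at
  most three parameters there.\<close>

lemma AE_circle_finite:
  assumes "finite A"
  shows "AE z in circle_measure. z \<notin> A"
proof (rule AE_I')
  have fin: "finite ({0..2 * pi} \<inter> cis -` {a})" for a
  proof (cases "{0..2 * pi} \<inter> cis -` {a} = {}")
    case False
    then obtain s where s: "s \<in> {0..2 * pi}" "cis s = a"
      by blast
    have "t \<in> {s - 2 * pi, s, s + 2 * pi}" if t: "t \<in> {0..2 * pi}" "cis t = a" for t
    proof -
      obtain n :: int where n: "t = s + 2 * pi * n"
        using sin_cos_eq_iff[of t s] t s by (auto simp: complex_eq_iff)
      have "(2 * pi) * -1 \<le> (2 * pi) * n" "(2 * pi) * n \<le> (2 * pi) * 1"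
        using n s(1) t(1) unfolding atLeastAtMost_iff by linarith+
      then have "-1 \<le> real_of_int n" "real_of_int n \<le> 1"
        by (simp_all only: mult_le_cancel_left_pos pi_gt_zero zero_less_mult_iff zero_less_numeral simp_thms)
      then have "n = -1 \<or> n = 0 \<or> n = 1"
        by linarith
      then show ?thesis
        using n by auto
    qed
    then have "{0..2 * pi} \<inter> cis -` {a} \<subseteq> {s - 2 * pi, s, s + 2 * pi}"
      by blast
    then show ?thesis
      by (rule finite_subset) simp
  qed simp
  have "{t \<in> {0..2 * pi}. cis t \<in> A} = (\<Union>a\<in>A. {0..2 * pi} \<inter> cis -` {a})"
    by auto
  then have "finite {t \<in> {0..2 * pi}. cis t \<in> A}"
    using assms fin by (simp del: UN_simps Int_UN_distrib)
  then have "measure lborel {t \<in> {0..2 * pi}. cis t \<in> A} = 0"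
    by (simp only: measure_eq_0_null_sets finite_imp_null_set_lborel)
  moreover have A: "A \<in> sets borel"
    using assms by (simp add: finite_imp_closed)
  ultimately have "measure circle_measure A = 0"
    by (simp add: measure_circle_eq)
  then show "A \<in> null_sets circle_measure"
    using A prob_space.finite_measure[OF prob_space_circle_measure]
    by (auto intro!: null_setsI simp: finite_measure.emeasure_eq_measure)
qed auto

section \<open>Parseval and Bernstein in mean square\<close>

lemma integral_cis_mult:
  assumes "m \<noteq> 0"
  shows "integral {0..2 * pi} (\<lambda>t. cis (of_int m * t)) = 0"
proof -
  define F where "F t = cis (of_int m * t) / (\<i> * of_int m)" for t
  have "((\<lambda>t. cis (of_int m * t)) has_integral (F (2 * pi) - F 0)) {0..2 * pi}"
  proof (rule fundamental_theorem_of_calculus)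
    fix t :: real
    have "((\<lambda>t. cis (of_int m * t)) has_vector_derivative \<i> * of_int m * cis (of_int m * t)) (at t)"
      unfolding has_vector_derivative_def
      by (auto intro!: derivative_eq_intros simp: scaleR_conv_of_real fun_eq_iff)
    then have "(F has_vector_derivative cis (of_int m * t)) (at t)"
      unfolding F_def using assms by (auto dest: has_vector_derivative_divide[where a = "\<i> * of_int m"])
    then show "(F has_vector_derivative cis (of_int m * t)) (at t within {0..2 * pi})"
      by (rule has_vector_derivative_at_within)
  qed simp
  moreover have "cis (of_int m * (2 * pi)) = 1"
    using cis_multiple_2pi[of "of_int m"] by (simp add: mult_ac)
  ultimately show ?thesis
    by (simp add: F_def integral_unique)
qed

lemma integral_circle_orthonormal:
  "(\<integral>z. z ^ j * cnj z ^ k \<partial>circle_measure) = (if j = k then 1 else 0)"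
proof -
  have "(\<integral>z. z ^ j * cnj z ^ k \<partial>circle_measure)
      = integral {0..2 * pi} (\<lambda>t. cis t ^ j * cnj (cis t) ^ k) /\<^sub>R (2 * pi)"
    by (intro integral_circle_continuous continuous_intros)
  also have "(\<lambda>t. cis t ^ j * cnj (cis t) ^ k) = (\<lambda>t. cis (of_int (int j - int k) * t))"
    by (simp add: fun_eq_iff cis_cnj Complex.DeMoivre cis_mult left_diff_distrib)
  also have "integral {0..2 * pi} \<dots> /\<^sub>R (2 * pi) = (if j = k then 1 else 0)"
    using integral_cis_mult[of "int j - int k"] by (auto simp: scaleR_conv_of_real)
  finally show ?thesis .
qed

theorem Parseval_poly:
  fixes P :: "complex poly"
  shows "(\<integral>z. (norm (poly P z))\<^sup>2 \<partial>circle_measure) = (\<Sum>k\<le>Polynomial.degree P. (norm (Polynomial.coeff P k))\<^sup>2)"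
proof -
  let ?a = "Polynomial.coeff P" and ?n = "Polynomial.degree P"
  have "complex_of_real (\<integral>z. (norm (poly P z))\<^sup>2 \<partial>circle_measure)
      = (\<integral>z. complex_of_real ((norm (poly P z))\<^sup>2) \<partial>circle_measure)"
    by (rule integral_complex_of_real[symmetric])
  also have "\<dots> = (\<integral>z. (\<Sum>j\<le>?n. \<Sum>k\<le>?n. ?a j * cnj (?a k) * (z ^ j * cnj z ^ k)) \<partial>circle_measure)"
    unfolding complex_norm_square poly_altdef
    by (simp add: sum_product cnj_sum mult_ac)
  also have "\<dots> = (\<Sum>j\<le>?n. \<Sum>k\<le>?n. ?a j * cnj (?a k) * (\<integral>z. z ^ j * cnj z ^ k \<partial>circle_measure))"
  proof -
    have i: "integrable circle_measure (\<lambda>z. c * (z ^ j * cnj z ^ k))" for c :: complex and j k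
      by (intro integrable_circle_continuous continuous_intros)
    have "(\<integral>z. (\<Sum>j\<le>?n. \<Sum>k\<le>?n. ?a j * cnj (?a k) * (z ^ j * cnj z ^ k)) \<partial>circle_measure)
        = (\<Sum>j\<le>?n. \<Sum>k\<le>?n. (\<integral>z. ?a j * cnj (?a k) * (z ^ j * cnj z ^ k) \<partial>circle_measure))"
      by (simp add: Bochner_Integration.integral_sum Bochner_Integration.integrable_sum i)
    then show ?thesis
      by simp
  qed
  also have "\<dots> = (\<Sum>j\<le>?n. ?a j * cnj (?a j))"
    unfolding integral_circle_orthonormal
    by (intro sum.cong refl) (simp add: if_distrib sum.delta cong: if_cong)
  also have "\<dots> = complex_of_real (\<Sum>k\<le>?n. (norm (?a k))\<^sup>2)"
    by (simp only: of_real_sum complex_norm_square)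
  finally show ?thesis
    by (simp only: of_real_eq_iff)
qed

text \<open>Differentiation multiplies the coefficient of \<open>z\<^sup>k\<close> by \<open>k \<le> n\<close>, so this is immediate from
  Parseval. The bound \<open>n\<close> instead of the degree is convenient for arcs of length \<open>2\<pi>/n\<close>.\<close>

lemma Bernstein_L2:
  fixes P :: "complex poly"
  assumes "Polynomial.degree P \<le> n"
  shows "(\<integral>z. (norm (poly (pderiv P) z))\<^sup>2 \<partial>circle_measure)
    \<le> (real n)\<^sup>2 * (\<integral>z. (norm (poly P z))\<^sup>2 \<partial>circle_measure)"
proof (cases "Polynomial.degree P")
  case 0
  then have "pderiv P = 0"
    by (simp add: pderiv_eq_0_iff)
  then show ?thesis
    by simp
next
  case (Suc d)
  have "(\<integral>z. (norm (poly (pderiv P) z))\<^sup>2 \<partial>circle_measure)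
      = (\<Sum>k\<le>d. (real (Suc k))\<^sup>2 * (norm (Polynomial.coeff P (Suc k)))\<^sup>2)"
    unfolding Parseval_poly degree_pderiv Suc
    by (simp add: coeff_pderiv norm_mult power_mult_distrib del: of_nat_Suc)
  also have "\<dots> \<le> (\<Sum>k\<le>d. (real n)\<^sup>2 * (norm (Polynomial.coeff P (Suc k)))\<^sup>2)"
    using assms Suc by (intro sum_mono mult_right_mono power_mono) auto
  also have "\<dots> = (real n)\<^sup>2 * (\<Sum>k\<le>d. (norm (Polynomial.coeff P (Suc k)))\<^sup>2)"
    by (simp add: sum_distrib_left)
  also have "\<dots> \<le> (real n)\<^sup>2 * (\<Sum>k\<le>Suc d. (norm (Polynomial.coeff P k))\<^sup>2)"
    by (intro mult_left_mono) (simp_all only: sum.atMost_Suc_shift le_add_same_cancel2 zero_le_power2)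
  also have "(\<Sum>k\<le>Suc d. (norm (Polynomial.coeff P k))\<^sup>2) = (\<integral>z. (norm (poly P z))\<^sup>2 \<partial>circle_measure)"
    unfolding Parseval_poly Suc by (rule refl)
  finally show ?thesis .
qed

section \<open>Zeros in many arcs force small values\<close>

text \<open>Cauchy-Schwarz for the integral of the derivative, in the linear form
  \<open>|P'| \<le> l/2 + |P'|\<^sup>2/(2l)\<close>. The free parameter \<open>l\<close> spares square roots and is chosen
  later to balance both terms.\<close>

lemma poly_cis_diff_le:
  fixes P :: "complex poly"
  assumes "a \<le> u" "u \<le> v" "v \<le> b" "0 < l"
    and D: "integral {a..b} (\<lambda>t. (norm (poly (pderiv P) (cis t)))\<^sup>2) \<le> D"
  shows "norm (poly P (cis v) - poly P (cis u)) \<le> l * (v - u) / 2 + D / (2 * l)"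
proof -
  let ?h = "\<lambda>t. norm (poly (pderiv P) (cis t))"
  let ?f = "\<lambda>t. poly (pderiv P) (cis t) * (\<i> * cis t)"
  have f: "(?f has_integral (poly P (cis v) - poly P (cis u))) {u..v}"
  proof (rule fundamental_theorem_of_calculus)
    fix t :: real
    have "(cis has_vector_derivative \<i> * cis t) (at t)"
      unfolding has_vector_derivative_def
      by (auto intro!: derivative_eq_intros simp: scaleR_conv_of_real)
    then have "((poly P \<circ> cis) has_vector_derivative \<i> * cis t * poly (pderiv P) (cis t)) (at t)"
      by (rule field_vector_diff_chain_at[OF _ poly_DERIV])
    then show "((\<lambda>t. poly P (cis t)) has_vector_derivative ?f t) (at t within {u..v})"
      by (simp add: o_def mult_ac has_vector_derivative_at_within)
  qed fact
  have int: "(\<lambda>t. (?h t)\<^sup>2) integrable_on {x..y}" for x y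
    by (intro integrable_continuous_real continuous_intros)
  have "(\<lambda>t. l / 2 + (1 / (2 * l)) * (?h t)\<^sup>2) integrable_on {u..v}"
    by (intro integrable_continuous_real continuous_intros)
  moreover have "norm (?f t) \<le> l / 2 + (1 / (2 * l)) * (?h t)\<^sup>2" for t
  proof -
    have "0 \<le> (?h t - l)\<^sup>2 / (2 * l)"
      using \<open>0 < l\<close> by simp
    also have "\<dots> = l / 2 + (1 / (2 * l)) * (?h t)\<^sup>2 - ?h t"
      using \<open>0 < l\<close> by (simp add: power2_eq_square field_simps)
    finally show ?thesis
      by (simp add: norm_mult)
  qed
  ultimately have "norm (integral {u..v} ?f) \<le> integral {u..v} (\<lambda>t. l / 2 + (1 / (2 * l)) * (?h t)\<^sup>2)"
    using f by (intro integral_norm_bound_integral) (auto simp: has_integral_iff)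
  also have "\<dots> = l * (v - u) / 2 + (1 / (2 * l)) * integral {u..v} (\<lambda>t. (?h t)\<^sup>2)"
  proof -
    have "integral {u..v} (\<lambda>t. l / 2 + (1 / (2 * l)) * (?h t)\<^sup>2)
       = integral {u..v} (\<lambda>t. l / 2) + integral {u..v} (\<lambda>t. (1 / (2 * l)) * (?h t)\<^sup>2)"
      by (rule Henstock_Kurzweil_Integration.integral_add) (intro integrable_continuous_real continuous_intros)+
    also have "integral {u..v} (\<lambda>t. l / 2) = l * (v - u) / 2"
      using \<open>u \<le> v\<close> by simp
    also have "integral {u..v} (\<lambda>t. (1 / (2 * l)) * (?h t)\<^sup>2) = (1 / (2 * l)) * integral {u..v} (\<lambda>t. (?h t)\<^sup>2)"
      by (rule integral_mult_right)
    finally show ?thesis .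
  qed
  also have "integral {u..v} (\<lambda>t. (?h t)\<^sup>2) \<le> integral {a..b} (\<lambda>t. (?h t)\<^sup>2)"
    using assms int by (intro integral_subset_le) auto
  also have "\<dots> \<le> D"
    by (rule D)
  finally show ?thesis
    using f \<open>0 < l\<close> by (simp add: integral_unique divide_right_mono)
qed

lemma sum_integral_consecutive:
  fixes f :: "real \<Rightarrow> real" and h :: "nat \<Rightarrow> real"
  assumes "continuous_on UNIV f" "mono h"
  shows "(\<Sum>j<m. integral {h j..h (Suc j)} f) = integral {h 0..h m} f"
proof (induction m)
  case (Suc m)
  have "integral {h 0..h m} f + integral {h m..h (Suc m)} f = integral {h 0..h (Suc m)} f"
    using assms
    by (intro Henstock_Kurzweil_Integration.integral_combine integrable_continuous_real)
       (auto simp: mono_def intro: continuous_on_subset)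
  then show ?case
    using Suc by simp
qed simp

text \<open>Let \<open>D j\<close> be the integral of \<open>|P'|\<^sup>2\<close> over the arc number \<open>j\<close>. These integrals add up to at most
  \<open>2\<pi>n\<^sup>2\<close>, so \<open>D j \<le> 4\<pi>n/c\<close> for all but \<open>cn/2\<close> of the arcs, hence for at least \<open>cn/2\<close> of the
  arcs that contain a zero. In each of those, \<open>|P| \<le> 1/2\<close> holds on an interval of length
  \<open>r = c/(16\<pi>n)\<close> that ends at the zero. The resulting total is \<open>cn/2 \<cdot> r = c\<^sup>2/(32\<pi>)\<close>, to be
  divided by the length \<open>2\<pi>\<close> of the circle.\<close>

theorem measure_small_values:
  fixes P :: "complex poly" and n :: nat and c :: real
  assumes norm1: "(\<integral>z. (norm (poly P z))\<^sup>2 \<partial>circle_measure) = 1"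
    and deg: "Polynomial.degree P \<le> n" and n: "0 < n"
    and J: "J \<subseteq> {..<n}" and c: "0 < c" "c * n \<le> card J"
    and zero: "\<And>j. j \<in> J \<Longrightarrow> \<exists>x \<in> {2 * pi * j / n .. 2 * pi * Suc j / n}. poly P (cis x) = 0"
  shows "(c / (8 * pi))\<^sup>2 \<le> measure circle_measure {z. norm (poly P z) \<le> 1 / 2}"
proof -
  define h where "h j = 2 * pi * real j / real n" for j :: nat
  define g where "g t = (norm (poly (pderiv P) (cis t)))\<^sup>2" for t
  define D where "D j = integral {h j..h (Suc j)} g" for j
  define r where "r = c / (16 * pi * n)"
  have [simp]: "h 0 = 0" "h n = 2 * pi"
    using n by (auto simp: h_def)
  have mono: "mono h"
    using n by (auto simp: h_def mono_def divide_right_mono)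
  have hS: "h (Suc j) = h j + 2 * pi / n" for j
    by (simp add: h_def add_divide_distrib distrib_left)
  have contg: "continuous_on UNIV g"
    unfolding g_def by (intro continuous_intros)
  have D_nonneg: "0 \<le> D j" for j
    unfolding D_def g_def by (rule Henstock_Kurzweil_Integration.integral_nonneg)
      (auto intro!: integrable_continuous_real continuous_intros)
  have finJ: "finite J"
    using J by (rule finite_subset) simp
  have c1: "c \<le> 1"
  proof -
    have "real (card J) \<le> n"
      using card_mono[OF _ J] by simp
    then have "c * real n \<le> 1 * real n"
      using c by linarith
    then show ?thesis
      using n by simp
  qed
  have sumD: "(\<Sum>j<n. D j) \<le> 2 * pi * (real n)\<^sup>2"
  proof -
    have "(\<Sum>j<n. D j) = integral {0..2 * pi} g"
      unfolding D_def by (subst sum_integral_consecutive[OF contg mono]) simp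
    also have "\<dots> = 2 * pi * (\<integral>z. (norm (poly (pderiv P) z))\<^sup>2 \<partial>circle_measure)"
      by (subst integral_circle_continuous) (auto intro!: continuous_intros simp: g_def[abs_def])
    also have "\<dots> \<le> 2 * pi * ((real n)\<^sup>2 * 1)"
      using Bernstein_L2[OF deg] norm1 by (intro mult_left_mono) auto
    finally show ?thesis
      by simp
  qed
  define G where "G = {j \<in> J. D j \<le> 4 * pi / c * n}"
  have cardG: "c * n / 2 \<le> card G"
  proof -
    have "card (J - G) * (4 * pi / c * n) = (\<Sum>j \<in> J - G. 4 * pi / c * n)"
      by simp
    also have "\<dots> \<le> (\<Sum>j \<in> J - G. D j)"
      by (intro sum_mono) (auto simp: G_def)
    also have "\<dots> \<le> (\<Sum>j<n. D j)"
      using J D_nonneg by (intro sum_mono2) auto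
    also have "\<dots> \<le> 2 * pi * (real n)\<^sup>2"
      by (rule sumD)
    finally have "card (J - G) * (4 * pi / c * n) \<le> c * n / 2 * (4 * pi / c * n)"
      using c by (simp add: power2_eq_square)
    moreover have "0 < 4 * pi / c * n"
      using n c by simp
    ultimately have "card (J - G) \<le> c * n / 2"
      by (simp only: mult_le_cancel_right_pos)
    moreover have "card J = card G + card (J - G)"
      using finJ by (subst card_Un_disjoint[symmetric]) (auto simp: G_def intro!: arg_cong[where f = card])
    ultimately show ?thesis
      using c by simp
  qed
  have rpos: "0 < r" and r: "r \<le> pi / n"
  proof -
    show "0 < r"
      using n c by (simp add: r_def)
    have "c \<le> 16 * pi * pi"
      using c1 pi_gt3 mult_mono[of 3 pi 3 pi] by simp
    then show "r \<le> pi / n"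
      using n by (simp add: r_def field_simps)
  qed
  have "\<exists>l. h j \<le> l \<and> l + r \<le> h (Suc j) \<and> (\<forall>t. l < t \<and> t < l + r \<longrightarrow> norm (poly P (cis t)) \<le> 1 / 2)"
    if j: "j \<in> G" for j
  proof -
    obtain x where x: "h j \<le> x" "x \<le> h (Suc j)" "poly P (cis x) = 0"
      using zero[of j] j by (auto simp: G_def h_def)
    \<comment> \<open>With this choice both terms of the bound in \<open>poly_cis_diff_le\<close> are at most \<open>1/4\<close>.\<close>
    define l where "l = 8 * pi / c * n"
    have l: "0 < l"
      using c n by (simp add: l_def)
    have Dj: "integral {h j..h (Suc j)} (\<lambda>t. (norm (poly (pderiv P) (cis t)))\<^sup>2) \<le> 4 * pi / c * n"
      using j by (simp add: G_def D_def g_def[abs_def])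
    have bd: "l * w / 2 + (4 * pi / c * n) / (2 * l) \<le> 1 / 2" if "w \<le> r" for w
    proof -
      have "l * w \<le> l * r"
        using that l by (intro mult_left_mono) auto
      also have "l * r = 1 / 2"
        using c n by (simp add: l_def r_def)
      finally have "l * w / 2 \<le> 1 / 4"
        by simp
      moreover have "(4 * pi / c * n) / (2 * l) = 1 / 4"
        using c n by (simp add: l_def)
      ultimately show ?thesis
        by linarith
    qed
    show ?thesis
    \<comment> \<open>Since \<open>r\<close> is at most half the length of the arc, there is room on at least one side of the zero.\<close>
    proof (cases "x + r \<le> h (Suc j)")
      case True
      have "norm (poly P (cis t)) \<le> 1 / 2" if "x < t" "t < x + r" for t
        using poly_cis_diff_le[OF _ _ _ l Dj, of x t] bd[of "t - x"] that x True by simp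
      then show ?thesis
        using True x by blast
    next
      case False
      then have "h j \<le> x - r"
        using hS[of j] r by simp
      have "norm (poly P (cis t)) \<le> 1 / 2" if "x - r < t" "t < x" for t
        using poly_cis_diff_le[OF _ _ _ l Dj, of t x] bd[of "x - t"] that x \<open>h j \<le> x - r\<close> by simp
      then show ?thesis
        using \<open>h j \<le> x - r\<close> x by (intro exI[of _ "x - r"]) auto
    qed
  qed
  then obtain L where L: "\<And>j. j \<in> G \<Longrightarrow> h j \<le> L j" "\<And>j. j \<in> G \<Longrightarrow> L j + r \<le> h (Suc j)"
    and small: "\<And>j t. j \<in> G \<Longrightarrow> L j < t \<Longrightarrow> t < L j + r \<Longrightarrow> norm (poly P (cis t)) \<le> 1 / 2"
    by metis
  define U where "U j = {L j<..<L j + r}" for j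
  have finG: "finite G"
    using finJ by (simp add: G_def)
  have disj: "disjoint_family_on U G"
  proof -
    have "U i \<inter> U j = {}" if "i \<in> G" "j \<in> G" "i < j" for i j
    proof -
      have "h (Suc i) \<le> h j"
        using mono that by (auto simp: mono_def)
      then show ?thesis
        using L that by (fastforce simp: U_def)
    qed
    then show ?thesis
      unfolding disjoint_family_on_def by (metis inf_commute linorder_neqE_nat)
  qed
  have "c\<^sup>2 / (32 * pi) = c * n / 2 * r"
    using n by (simp add: r_def power2_eq_square)
  also have "\<dots> \<le> card G * r"
    using cardG rpos by (intro mult_right_mono) auto
  also have "\<dots> = (\<Sum>j\<in>G. measure lborel (U j))"
    using rpos by (simp add: U_def)
  also have "\<dots> = measure lborel (\<Union>j\<in>G. U j)"
    by (rule measure_finite_Union[symmetric, OF finG _ disj]) (use rpos in \<open>auto simp: U_def\<close>)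
  also have "\<dots> \<le> measure lborel {t \<in> {0..2 * pi}. cis t \<in> {z. norm (poly P z) \<le> 1 / 2}}"
  proof (rule measure_mono_fmeasurable)
    show "(\<Union>j\<in>G. U j) \<subseteq> {t \<in> {0..2 * pi}. cis t \<in> {z. norm (poly P z) \<le> 1 / 2}}"
    proof
      fix t assume "t \<in> (\<Union>j\<in>G. U j)"
      then obtain j where j: "j \<in> G" "L j < t" "t < L j + r"
        by (auto simp: U_def)
      have "Suc j \<le> n"
        using j J by (auto simp: G_def)
      then have "h 0 \<le> h j" "h (Suc j) \<le> h n"
        using monoD[OF mono] by blast+
      then show "t \<in> {t \<in> {0..2 * pi}. cis t \<in> {z. norm (poly P z) \<le> 1 / 2}}"
        using L[of j] j small[of j t] by simp
    qed
    show "(\<Union>j\<in>G. U j) \<in> sets lborel"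
      by (auto simp: U_def finG)
    have "compact ({0..2 * pi} \<inter> {t. norm (poly P (cis t)) \<le> 1 / 2})"
      by (intro compact_Int_closed closed_Collect_le continuous_intros) auto
    then show "{t \<in> {0..2 * pi}. cis t \<in> {z. norm (poly P z) \<le> 1 / 2}} \<in> fmeasurable lborel"
      by (simp add: Int_def fmeasurable_compact)
  qed
  finally have "c\<^sup>2 / (32 * pi) / (2 * pi)
      \<le> measure lborel {t \<in> {0..2 * pi}. cis t \<in> {z. norm (poly P z) \<le> 1 / 2}} / (2 * pi)"
    by (intro divide_right_mono) auto
  moreover have "{z. norm (poly P z) \<le> 1 / 2} \<in> sets borel"
    by (intro borel_closed closed_Collect_le continuous_intros)
  ultimately show ?thesis
    by (simp add: measure_circle_eq power2_eq_square)
qed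

section \<open>Integrability of the logarithm of a polynomial\<close>

text \<open>A weak form of Jordan's inequality: \<open>|sin x - x| \<le> |x|\<^sup>3/6\<close>, and \<open>x\<^sup>2 < 3\<close> on the interval in question.\<close>

lemma half_le_abs_sin:
  fixes x :: real
  assumes "\<bar>x\<bar> \<le> pi / 2"
  shows "\<bar>x\<bar> / 2 \<le> \<bar>sin x\<bar>"
proof -
  have "\<bar>sin x - (\<Sum>m<3. sin_coeff m * x ^ m)\<bar> \<le> inverse (fact 3) * \<bar>x\<bar> ^ 3"
    by (rule Maclaurin_sin_bound)
  moreover have "(\<Sum>m<3. sin_coeff m * x ^ m) = x"
    by (simp add: sin_coeff_def numeral_3_eq_3)
  moreover have "inverse (fact 3) * \<bar>x\<bar> ^ 3 \<le> \<bar>x\<bar> / 2"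
  proof -
    have "pi / 2 \<le> 8 / 5"
      using pi_approx by simp
    then have "\<bar>x\<bar>\<^sup>2 \<le> (8 / 5)\<^sup>2"
      using assms by (intro power_mono) auto
    then have "\<bar>x\<bar> * \<bar>x\<bar>\<^sup>2 \<le> \<bar>x\<bar> * 3"
      by (intro mult_left_mono) (auto simp: power2_eq_square)
    then show ?thesis
      by (simp add: fact_numeral power3_eq_cube power2_eq_square)
  qed
  ultimately show ?thesis
    by linarith
qed

lemma norm_cis_diff: "norm (cis t - cis s) = 2 * \<bar>sin ((t - s) / 2)\<bar>"
proof -
  have "cis t - cis s = cis s * (exp (\<i> * of_real (t - s)) - 1)"
    by (simp only: right_diff_distrib mult_1_right cis_conv_exp[symmetric] cis_mult add_diff_cancel_left' add_diff_eq)
  then show ?thesis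
    by (simp only: norm_mult norm_cis dist_exp_i_1)
qed

lemma norm_cis_diff_ge: "\<bar>t - s\<bar> \<le> pi \<Longrightarrow> \<bar>t - s\<bar> / 2 \<le> norm (cis t - cis s)"
  unfolding norm_cis_diff using half_le_abs_sin[of "(t - s) / 2"] by simp

text \<open>A logarithmic singularity is dominated by an inverse square root, whose antiderivative
  extends continuously to the singularity.\<close>

lemma set_integrable_inverse_sqrt:
  fixes s a b :: real
  shows "set_integrable lborel {a..b} (\<lambda>t. 1 / sqrt \<bar>t - s\<bar>)"
proof (cases "a \<le> b")
  case True
  define F where F: "F = (\<lambda>t. if t \<le> s then - (2 * sqrt (s - t)) else 2 * sqrt (t - s))"
  have "((\<lambda>t. 1 / sqrt \<bar>t - s\<bar>) has_integral (F b - F a)) {a..b}"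
  proof (rule fundamental_theorem_of_calculus_strong[where S = "{s}"])
    fix t assume t: "t \<in> {a..b} - {s}"
    show "(F has_vector_derivative 1 / sqrt \<bar>t - s\<bar>) (at t)"
    proof (cases "t < s")
      case True
      have "((\<lambda>t. - (2 * sqrt (s - t))) has_real_derivative 1 / sqrt \<bar>t - s\<bar>) (at t)"
        using True by (auto intro!: derivative_eq_intros simp: field_simps)
      then have "(F has_real_derivative 1 / sqrt \<bar>t - s\<bar>) (at t)"
        by (rule has_field_derivative_transform_within_open[where S = "{..<s}"]) (use True in \<open>auto simp: F\<close>)
      then show ?thesis
        by (simp add: has_real_derivative_iff_has_vector_derivative)
    next
      case False
      then have "s < t"
        using t by auto
      have "((\<lambda>t. 2 * sqrt (t - s)) has_real_derivative 1 / sqrt \<bar>t - s\<bar>) (at t)"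
        using \<open>s < t\<close> by (auto intro!: derivative_eq_intros simp: field_simps)
      then have "(F has_real_derivative 1 / sqrt \<bar>t - s\<bar>) (at t)"
        by (rule has_field_derivative_transform_within_open[where S = "{s<..}"]) (use \<open>s < t\<close> in \<open>auto simp: F\<close>)
      then show ?thesis
        by (simp add: has_real_derivative_iff_has_vector_derivative)
    qed
  next
    have "continuous_on ({..s} \<union> {s..}) F"
      unfolding F by (rule continuous_on_If) (auto intro!: continuous_intros)
    then show "continuous_on {a..b} F"
      by (rule continuous_on_subset) auto
  qed (use True in auto)
  then have "(\<lambda>t. 1 / sqrt \<bar>t - s\<bar>) absolutely_integrable_on {a..b}"
    by (intro nonnegative_absolutely_integrable_1) (auto simp: has_integral_iff)
  then show ?thesis
    unfolding set_integrable_def by (subst (asm) integrable_completion) auto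
qed simp

lemma abs_ln_le:
  fixes y :: real
  assumes "0 < y" "y \<le> 2"
  shows "\<bar>ln y\<bar> \<le> 2 + 2 / sqrt y"
proof -
  have "ln y \<le> y - 1"
    using assms by (intro ln_le_minus_one)
  moreover have "- ln y \<le> 2 / sqrt y"
  proof -
    have "- ln y = 2 * ln (1 / sqrt y)"
      using assms by (simp add: ln_div ln_sqrt)
    also have "\<dots> \<le> 2 * (1 / sqrt y - 1)"
      using assms by (intro mult_left_mono ln_le_minus_one) auto
    also have "\<dots> \<le> 2 / sqrt y"
      by simp
    finally show ?thesis .
  qed
  moreover have "0 \<le> 2 / sqrt y"
    using assms by simp
  ultimately show ?thesis
    using assms by linarith
qed

text \<open>Only \<open>a\<close> on the circle needs an argument. Then \<open>|cis t - a|\<close> is bounded below by a multiple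
  of the distance from \<open>t\<close> to the nearest parameter of \<open>a\<close>. For parameters in \<open>[0, 2\<pi>]\<close> this
  nearest parameter can lie one period to the left or right, so that three singularities enter
  the dominating function.\<close>

lemma integrable_ln_norm_diff: "integrable circle_measure (\<lambda>z. ln (norm (z - a)))"
proof -
  have m: "(\<lambda>z. ln (norm (z - a))) \<in> borel_measurable borel"
    by measurable
  have "set_integrable lborel {0..2 * pi} (\<lambda>t. ln (norm (cis t - a)))"
  proof (cases "norm a = 1")
    case False
    then have "cis t \<noteq> a" for t
      by auto
    then show ?thesis
      by (intro borel_integrable_atLeastAtMost' continuous_intros) auto
  next
    case True
    obtain s where s: "0 \<le> s" "s < 2 * pi" and "a = Complex (cos s) (sin s)"
      using complex_unimodular_polar[OF True] .
    then have a: "a = cis s"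
      by (simp add: complex_eq_iff)
    define S where "S = {s - 2 * pi, s, s + 2 * pi}"
    define k where "k u t = 4 * (1 / sqrt \<bar>t - u\<bar>)" for u t :: real
    define g where "g t = 2 + (k (s - 2 * pi) t + (k s t + k (s + 2 * pi) t))" for t
    have k: "0 \<le> k u t" for u t
      by (simp add: k_def)
    have "set_integrable lborel {0..2 * pi} g"
      unfolding g_def k_def
      by (intro set_integral_add set_integrable_mult_right set_integrable_inverse_sqrt
          borel_integrable_atLeastAtMost' continuous_intros)
    then show ?thesis
      unfolding set_integrable_def
    proof (rule Bochner_Integration.integrable_bound)
      have "norm (ln (norm (cis t - a))) \<le> g t" if t: "t \<in> {0..2 * pi}" for t
      proof (cases "cis t = a")
        case True
        then show ?thesis
          by (simp add: g_def k)
      next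
        case False
        obtain u where u: "u \<in> S" "\<bar>t - u\<bar> \<le> pi"
        proof -
          have "\<bar>t - s\<bar> \<le> pi \<or> \<bar>t - (s - 2 * pi)\<bar> \<le> pi \<or> \<bar>t - (s + 2 * pi)\<bar> \<le> pi"
            using s t by auto
          then show thesis
            using that by (auto simp: S_def)
        qed
        have cu: "cis u = a"
          using u(1) unfolding S_def a by (auto simp: complex_eq_iff cos_diff sin_diff)
        define y where "y = norm (cis t - a)"
        have y: "0 < y" "y \<le> 2"
          using False norm_triangle_ineq4[of "cis t" a] True by (auto simp: y_def)
        have pos: "0 < \<bar>t - u\<bar>"
          using False cu by auto
        have le: "\<bar>t - u\<bar> / 2 \<le> y"
          using norm_cis_diff_ge[OF u(2)] by (simp add: y_def cu)
        have "sqrt \<bar>t - u\<bar> / 2 \<le> sqrt (\<bar>t - u\<bar> / 2)"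
          by (rule real_le_rsqrt) (simp add: power_divide)
        also have "\<dots> \<le> sqrt y"
          using le by simp
        finally have "1 / sqrt y \<le> 1 / (sqrt \<bar>t - u\<bar> / 2)"
          using pos by (intro divide_left_mono) (auto simp: y)
        then have "2 / sqrt y \<le> k u t"
          by (simp add: k_def)
        then have "2 + 2 / sqrt y \<le> g t"
          using u(1) k[of "s - 2 * pi" t] k[of s t] k[of "s + 2 * pi" t] by (auto simp: S_def g_def)
        then show ?thesis
          using abs_ln_le[OF y] by (simp add: y_def)
      qed
      then show "AE t in lborel. norm (indicat_real {0..2 * pi} t *\<^sub>R ln (norm (cis t - a)))
          \<le> norm (indicat_real {0..2 * pi} t *\<^sub>R g t)"
        by (intro AE_I2) (auto split: split_indicator intro: order_trans[OF _ abs_ge_self])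
    qed measurable
  qed
  then show ?thesis
    by (simp add: integrable_circle_iff[OF m])
qed

lemma borel_measurable_poly [measurable]: "(\<lambda>z. poly (P :: complex poly) z) \<in> borel_measurable borel"
  by (intro borel_measurable_continuous_onI continuous_intros)

lemma integrable_ln_norm_poly:
  fixes P :: "complex poly"
  assumes "P \<noteq> 0"
  shows "integrable circle_measure (\<lambda>z. ln (norm (poly P z)))"
  using assms
proof (induction "Polynomial.degree P" arbitrary: P)
  case 0
  then obtain c where "P = [:c:]"
    by (metis degree_0_id)
  then show ?case
    by (simp add: integrable_circle_continuous)
next
  case (Suc d)
  then have "\<not> constant (poly P)"
    by (simp add: constant_degree)
  then obtain a where "poly P a = 0"
    using fundamental_theorem_of_algebra by blast
  then obtain Q where P: "P = [:-a, 1:] * Q"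
    by (auto simp: poly_eq_0_iff_dvd dvd_def)
  then have "Q \<noteq> 0"
    using Suc.prems by auto
  then have "Polynomial.degree P = Suc (Polynomial.degree Q)"
    unfolding P by (subst degree_mult_eq) auto
  then have Q: "Q \<noteq> 0" "d = Polynomial.degree Q"
    using Suc.hyps(2) \<open>Q \<noteq> 0\<close> by simp_all
  have "integrable circle_measure (\<lambda>z. ln (norm (z - a)) + ln (norm (poly Q z)))"
    using Suc.hyps(1)[OF Q(2) Q(1)] integrable_ln_norm_diff by (intro Bochner_Integration.integrable_add)
  moreover have "AE z in circle_measure. z \<notin> {z. poly P z = 0}"
    by (rule AE_circle_finite) (simp add: poly_roots_finite Suc.prems)
  then have "AE z in circle_measure. ln (norm (z - a)) + ln (norm (poly Q z)) = ln (norm (poly P z))"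
  proof eventually_elim
    case (elim z)
    have "poly P z = (z - a) * poly Q z"
      by (simp add: P left_diff_distrib)
    then show ?case
      using elim by (simp add: norm_mult ln_mult)
  qed
  ultimately show ?case
    by (subst integrable_cong_AE[symmetric]) (simp_all, measurable)
qed

text \<open>The inequality \<open>ln y \<le> (y\<^sup>2 - 1)/2\<close> is sharp only at \<open>y = 1\<close>. The gain for \<open>x \<le> 1/2\<close> comes from
  applying it to \<open>2x\<close> and using \<open>ln 2 \<ge> 1/2\<close>.\<close>

lemma ln_le_quadratic:
  fixes x :: real
  assumes "0 < x"
  shows "ln x \<le> (x\<^sup>2 - 1) / 2 - (if x \<le> 1 / 2 then 1 / 8 else 0)"
proof -
  have *: "ln y \<le> (y\<^sup>2 - 1) / 2" if "0 < y" for y :: real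
    using ln_le_minus_one[of "y\<^sup>2"] that by (simp add: ln_realpow)
  show ?thesis
  proof (cases "x \<le> 1 / 2")
    case True
    have "ln x = ln (2 * x) + ln (1 / 2)"
      using assms by (simp add: ln_mult ln_div)
    moreover have "ln (1 / 2) \<le> (1 / 2 - 1 :: real)"
      by (rule ln_le_minus_one) simp
    moreover have "ln (2 * x) \<le> ((2 * x)\<^sup>2 - 1) / 2"
      using assms by (intro *) simp
    moreover have "x\<^sup>2 \<le> (1 / 2)\<^sup>2"
      using True assms by (intro power_mono) auto
    ultimately show ?thesis
      using True by (simp add: power2_eq_square field_simps)
  qed (use *[OF assms] in simp)
qed

text \<open>Since \<open>|P|\<^sup>2\<close> has mean \<open>1\<close>, integrating \<open>ln_le_quadratic\<close> leaves just the gain on the set of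
  small values. At zeros of \<open>P\<close> the convention \<open>ln 0 = 0\<close> violates that inequality, but they
  form a null set.\<close>

lemma mahler_le_of_small_values:
  fixes P :: "complex poly"
  assumes norm1: "(\<integral>z. (norm (poly P z))\<^sup>2 \<partial>circle_measure) = 1"
  shows "mahler (poly P) \<le> exp (- (measure circle_measure {z. norm (poly P z) \<le> 1 / 2} / 8))"
proof -
  interpret prob_space circle_measure
    by (rule prob_space_circle_measure)
  let ?S = "{z. norm (poly P z) \<le> 1 / 2}"
  have S: "?S \<in> sets borel"
    by (intro borel_closed closed_Collect_le continuous_intros)
  have "P \<noteq> 0"
    using norm1 by auto
  have i: "integrable circle_measure (\<lambda>z. (norm (poly P z))\<^sup>2)"
    by (intro integrable_circle_continuous continuous_intros)
  have iS: "integrable circle_measure (indicat_real ?S)"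
    using S by (intro integrable_const_bound[where B = 1] AE_I2) (auto split: split_indicator)
  have "(\<integral>z. ln (norm (poly P z)) \<partial>circle_measure)
      \<le> (\<integral>z. ((norm (poly P z))\<^sup>2 - 1) / 2 - indicat_real ?S z / 8 \<partial>circle_measure)"
  proof (rule integral_mono_AE)
    have "AE z in circle_measure. z \<notin> {z. poly P z = 0}"
      by (rule AE_circle_finite) (simp add: poly_roots_finite \<open>P \<noteq> 0\<close>)
    then show "AE z in circle_measure. ln (norm (poly P z))
        \<le> ((norm (poly P z))\<^sup>2 - 1) / 2 - indicat_real ?S z / 8"
    proof eventually_elim
      case (elim z)
      then show ?case
        using ln_le_quadratic[of "norm (poly P z)"] by (auto split: split_indicator if_splits)
    qed
    show "integrable circle_measure (\<lambda>z. ((norm (poly P z))\<^sup>2 - 1) / 2 - indicat_real ?S z / 8)"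
      by (intro Bochner_Integration.integrable_diff integrable_divide i iS integrable_const)
  qed (rule integrable_ln_norm_poly[OF \<open>P \<noteq> 0\<close>])
  also have "\<dots> = - (measure circle_measure ?S / 8)"
    using i iS S norm1 by (simp add: prob_space[simplified])
  finally show ?thesis
    by (simp add: mahler_def)
qed

lemma L_norm_ge_of_small_values:
  fixes P :: "complex poly"
  assumes "0 < \<alpha>"
  shows "measure circle_measure {z. norm (poly P z) \<le> 1 / 2} powr (1 / \<alpha>) / 2
    \<le> L_norm \<alpha> (\<lambda>z. norm (poly P z) - 1)"
proof -
  interpret prob_space circle_measure
    by (rule prob_space_circle_measure)
  let ?S = "{z. norm (poly P z) \<le> 1 / 2}"
  have S: "?S \<in> sets borel"
    by (intro borel_closed closed_Collect_le continuous_intros)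
  have iS: "integrable circle_measure (indicat_real ?S)"
    using S by (intro integrable_const_bound[where B = 1] AE_I2) (auto split: split_indicator)
  have "(1 / 2) powr \<alpha> * measure circle_measure ?S = (\<integral>z. (1 / 2) powr \<alpha> * indicat_real ?S z \<partial>circle_measure)"
    using S by simp
  also have "\<dots> \<le> (\<integral>z. norm (norm (poly P z) - 1) powr \<alpha> \<partial>circle_measure)"
  proof (rule integral_mono)
    show "integrable circle_measure (\<lambda>z. norm (norm (poly P z) - 1) powr \<alpha>)"
      using assms by (intro integrable_circle_continuous continuous_on_powr' continuous_intros) auto
    show "(1 / 2) powr \<alpha> * indicat_real ?S z \<le> norm (norm (poly P z) - 1) powr \<alpha>" for z
      using assms by (auto split: split_indicator intro!: powr_mono2)
  qed (intro integrable_mult_right iS)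
  finally have "((1 / 2) powr \<alpha> * measure circle_measure ?S) powr (1 / \<alpha>)
      \<le> (\<integral>z. norm (norm (poly P z) - 1) powr \<alpha> \<partial>circle_measure) powr (1 / \<alpha>)"
    using assms by (intro powr_mono2) auto
  then show ?thesis
    using assms by (simp add: L_norm_def powr_mult powr_powr)
qed

theorem not_L_flat_if_small_values:
  fixes q :: "'i \<Rightarrow> complex poly"
  assumes "0 \<le> \<alpha>" "F \<noteq> bot" "0 < m"
    and ev: "\<forall>\<^sub>F n in F. (\<integral>z. (norm (poly (q n) z))\<^sup>2 \<partial>circle_measure) = 1
      \<and> m \<le> measure circle_measure {z. norm (poly (q n) z) \<le> 1 / 2}"
  shows "\<not> L_flat \<alpha> F q"
proof
  assume flat: "L_flat \<alpha> F q"
  show False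
  proof (cases "\<alpha> = 0")
    case True
    have "\<forall>\<^sub>F n in F. L_norm 0 (poly (q n)) \<le> exp (- (m / 8))"
      using ev
    proof eventually_elim
      case (elim n)
      then have "L_norm 0 (poly (q n)) \<le> exp (- (measure circle_measure {z. norm (poly (q n) z) \<le> 1 / 2} / 8))"
        using mahler_le_of_small_values[of "q n"] by (simp add: L_norm_def)
      also have "\<dots> \<le> exp (- (m / 8))"
        using elim by simp
      finally show ?case .
    qed
    moreover have "((\<lambda>n. L_norm 0 (poly (q n))) \<longlongrightarrow> 1) F"
      using flat True by (simp add: L_flat_def)
    ultimately have "1 \<le> exp (- (m / 8))"
      using \<open>F \<noteq> bot\<close> by (intro tendsto_upperbound)
    then show False
      using \<open>0 < m\<close> by simp
  next
    case False
    then have \<alpha>: "0 < \<alpha>"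
      using \<open>0 \<le> \<alpha>\<close> by simp
    have "\<forall>\<^sub>F n in F. m powr (1 / \<alpha>) / 2 \<le> L_norm \<alpha> (\<lambda>z. norm (poly (q n) z) - 1)"
      using ev
    proof eventually_elim
      case (elim n)
      then have "m powr (1 / \<alpha>) / 2 \<le> measure circle_measure {z. norm (poly (q n) z) \<le> 1 / 2} powr (1 / \<alpha>) / 2"
        using \<alpha> \<open>0 < m\<close> by (intro divide_right_mono powr_mono2) auto
      then show ?case
        using L_norm_ge_of_small_values[OF \<alpha>, of "q n"] by linarith
    qed
    moreover have "((\<lambda>n. L_norm \<alpha> (\<lambda>z. norm (poly (q n) z) - 1)) \<longlongrightarrow> 0) F"
      using flat False by (simp add: L_flat_def)
    ultimately have "m powr (1 / \<alpha>) / 2 \<le> 0"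
      using \<open>F \<noteq> bot\<close> by (intro tendsto_lowerbound)
    then show False
      using \<open>0 < m\<close> by simp
  qed
qed

section \<open>Zeros of Fekete polynomials\<close>

lemma Legendre_values: "Legendre a p \<in> {-1, 0, 1}"
  by (simp add: Legendre_def)

lemma Legendre_cong:
  assumes "[a = b] (mod p)"
  shows "Legendre a p = Legendre b p"
proof -
  have "[a = c] (mod p) \<longleftrightarrow> [b = c] (mod p)" "[c = a] (mod p) \<longleftrightarrow> [c = b] (mod p)" for c
    using assms by (metis cong_sym cong_trans)+
  then show ?thesis
    by (simp add: Legendre_def QuadRes_def)
qed

lemma Legendre_mult:
  assumes "prime p" "2 < p"
  shows "Legendre (a * b) (int p) = Legendre a (int p) * Legendre b (int p)"
proof -
  let ?L = "\<lambda>a. Legendre a (int p)" and ?m = "(p - 1) div 2"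
  have "[?L (a * b) = (a * b) ^ ?m] (mod int p)"
    by (rule euler_criterion[OF assms])
  moreover have "[?L a * ?L b = a ^ ?m * b ^ ?m] (mod int p)"
    by (intro cong_mult euler_criterion[OF assms])
  ultimately have "[?L (a * b) = ?L a * ?L b] (mod int p)"
    by (metis cong_sym cong_trans power_mult_distrib)
  then have "int p dvd ?L (a * b) - ?L a * ?L b"
    by (simp add: cong_iff_dvd_diff)
  moreover have "\<bar>?L (a * b) - ?L a * ?L b\<bar> < int p"
    using assms(2) Legendre_values[of a "int p"] Legendre_values[of b "int p"] Legendre_values[of "a * b" "int p"]
    by auto
  ultimately show ?thesis
    using zdvd_not_zless[of "\<bar>?L (a * b) - ?L a * ?L b\<bar>" "int p"] by auto
qed

lemma Legendre_eq_0_iff: "Legendre a p = 0 \<longleftrightarrow> p dvd a"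
  by (auto simp: Legendre_def cong_0_iff)

lemma poly_fekete: "poly (fekete p) z = (\<Sum>k = 1..p - 1. of_int (Legendre (int k) (int p)) * z ^ k)"
  by (simp add: fekete_def poly_sum poly_monom)

lemma coeff_fekete:
  "Polynomial.coeff (fekete p) k = (if k \<in> {1..p - 1} then of_int (Legendre (int k) (int p)) else 0)"
  by (simp add: fekete_def coeff_sum sum.delta)

lemma degree_fekete: "Polynomial.degree (fekete p) \<le> p"
  by (rule degree_le) (auto simp: coeff_fekete)

lemma cis_mult_mod:
  assumes "0 < p"
  shows "cis (2 * pi * real (m mod p) / real p) = cis (2 * pi * real m / real p)"
proof -
  have "real m = real (m div p) * real p + real (m mod p)"
    by (metis div_mult_mod_eq of_nat_add of_nat_mult)
  then have "2 * pi * real m / real p = 2 * pi * real (m div p) + 2 * pi * real (m mod p) / real p"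
    using assms by (simp add: field_simps)
  moreover have "cis (2 * pi * real (m div p)) = 1"
    by (rule cis_multiple_2pi) simp
  ultimately show ?thesis
    by (simp add: cis_mult[symmetric])
qed

text \<open>Multiplication by \<open>j\<close> permutes the nonzero residues, and \<open>\<chi>(k) = \<chi>(j) \<chi>(jk)\<close>. This is the
  classical evaluation of twisted Gauss sums in terms of a single one.\<close>

lemma fekete_at_root_of_unity:
  assumes p: "prime p" "2 < p" and j: "\<not> p dvd j"
  shows "poly (fekete p) (cis (2 * pi * real j / real p))
    = of_int (Legendre (int j) (int p)) * poly (fekete p) (cis (2 * pi / real p))"
proof -
  let ?L = "\<lambda>k. Legendre (int k) (int p)"
  define f where "f m = of_int (?L m) * cis (2 * pi * real m / real p)" for m
  have "bij_betw (\<lambda>k. j * k mod p) {1..p - 1} {1..p - 1}"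
  proof -
    have cop: "coprime j p"
      using p(1) j by (metis coprime_commute prime_imp_coprime)
    have "inj_on (\<lambda>k. j * k mod p) {1..p - 1}"
    proof (rule inj_onI)
      fix k l assume kl: "k \<in> {1..p - 1}" "l \<in> {1..p - 1}" "j * k mod p = j * l mod p"
      then have "[k = l] (mod p)"
        using cong_mult_lcancel_nat[OF cop] by (simp add: cong_def)
      then show "k = l"
        using kl(1,2) p by (intro cong_less_modulus_unique_nat[of k l p]) auto
    qed
    moreover have "(\<lambda>k. j * k mod p) ` {1..p - 1} \<subseteq> {1..p - 1}"
    proof
      fix m assume "m \<in> (\<lambda>k. j * k mod p) ` {1..p - 1}"
      then obtain k where k: "1 \<le> k" "k \<le> p - 1" and m: "m = j * k mod p"
        by auto
      have "\<not> p dvd k"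
        using k p by (auto dest: dvd_imp_le)
      then have "\<not> p dvd j * k"
        using j p by (simp add: prime_dvd_mult_iff)
      then have "m \<noteq> 0"
        by (simp add: m dvd_eq_mod_eq_0)
      moreover have "m < p"
        using p by (simp add: m)
      ultimately show "m \<in> {1..p - 1}"
        by auto
    qed
    ultimately show ?thesis
      using endo_inj_surj[of "{1..p - 1}"] by (auto simp: bij_betw_def)
  qed
  then have "(\<Sum>k = 1..p - 1. f (j * k mod p)) = (\<Sum>m = 1..p - 1. f m)"
    by (rule sum.reindex_bij_betw)
  moreover have "f (j * k mod p) = of_int (?L j) * (of_int (?L k) * cis (2 * pi * real j / real p) ^ k)" for k
  proof -
    have "?L (j * k mod p) = ?L (j * k)"
      by (rule Legendre_cong) (simp add: cong_def zmod_int)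
    also have "\<dots> = ?L j * ?L k"
      using Legendre_mult[OF p] by simp
    finally show ?thesis
      using cis_mult_mod[of p "j * k"] p by (simp add: f_def Complex.DeMoivre mult_ac)
  qed
  ultimately have "of_int (?L j) * poly (fekete p) (cis (2 * pi * real j / real p)) = (\<Sum>m = 1..p - 1. f m)"
    by (simp add: poly_fekete sum_distrib_left)
  also have "\<dots> = poly (fekete p) (cis (2 * pi / real p))"
    by (simp add: poly_fekete f_def Complex.DeMoivre mult_ac)
  finally have "of_int (?L j) * (of_int (?L j) * poly (fekete p) (cis (2 * pi * real j / real p)))
      = of_int (?L j) * poly (fekete p) (cis (2 * pi / real p))"
    by simp
  moreover have "?L j * ?L j = 1"
    using Legendre_values[of "int j" "int p"] Legendre_eq_0_iff[of "int j" "int p"] j by auto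
  ultimately show ?thesis
    by (simp flip: mult.assoc of_int_mult)
qed

text \<open>Reflecting \<open>k\<close> to \<open>p - k\<close> conjugates \<open>z\<^sup>k\<close> up to the factor \<open>z\<^sup>p\<close> and multiplies its coefficient
  by \<open>\<chi>(-1)\<close>. Splitting \<open>z\<^sup>p\<close> evenly makes the function real or purely imaginary.\<close>

lemma fekete_self_reciprocal:
  assumes p: "prime p" "2 < p"
  shows "cnj (cis (- (real p * t / 2)) * poly (fekete p) (cis t))
    = of_int (Legendre (- 1) (int p)) * (cis (- (real p * t / 2)) * poly (fekete p) (cis t))"
proof -
  let ?L = "\<lambda>k. Legendre (int k) (int p)"
  have "cnj (cis (- (real p * t / 2)) * poly (fekete p) (cis t))
      = (\<Sum>k = 1..p - 1. of_int (?L k) * cis (real p * t / 2 - real k * t))"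
    by (simp add: poly_fekete cis_cnj Complex.DeMoivre sum_distrib_left cis_mult mult.left_commute[of "cis _"])
  also have "\<dots> = (\<Sum>k = 1..p - 1. of_int (?L (p - k)) * cis (real p * t / 2 - real (p - k) * t))"
    by (rule sum.reindex_bij_witness[of _ "\<lambda>k. p - k" "\<lambda>k. p - k"]) (use p in auto)
  also have "\<dots> = (\<Sum>k = 1..p - 1. of_int (Legendre (- 1) (int p)) *
      (cis (- (real p * t / 2)) * (of_int (?L k) * cis t ^ k)))"
  proof (rule sum.cong)
    fix k assume k: "k \<in> {1..p - 1}"
    have "?L (p - k) = Legendre (- 1 * int k) (int p)"
      using k by (intro Legendre_cong) (auto simp: of_nat_diff cong_iff_dvd_diff)
    then have "?L (p - k) = Legendre (- 1) (int p) * ?L k"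
      by (simp only: Legendre_mult[OF p])
    moreover
    have "real p * t / 2 - real (p - k) * t = - (real p * t / 2) + real k * t"
    proof -
      have "real (p - k) = real p - real k"
        using k by (intro of_nat_diff) auto
      then show ?thesis
        by (simp add: algebra_simps)
    qed
    then have "cis (real p * t / 2 - real (p - k) * t) = cis (- (real p * t / 2)) * cis t ^ k"
      by (simp only: Complex.DeMoivre cis_mult)
    ultimately show "of_int (?L (p - k)) * cis (real p * t / 2 - real (p - k) * t)
        = of_int (Legendre (- 1) (int p)) * (cis (- (real p * t / 2)) * (of_int (?L k) * cis t ^ k))"
      by simp
  qed simp
  also have "\<dots> = of_int (Legendre (- 1) (int p)) * (cis (- (real p * t / 2)) * poly (fekete p) (cis t))"
    by (simp only: poly_fekete sum_distrib_left)
  finally show ?thesis .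
qed

text \<open>The half-integer twist contributes a sign change from one \<open>p\<close>-th root of unity to the next, so
  equal Legendre symbols mean opposite signs and the intermediate value theorem applies.\<close>

theorem fekete_zero_between:
  assumes p: "prime p" "2 < p" and j: "1 \<le> j" "j \<le> p - 2"
    and eq: "Legendre (int j) (int p) = Legendre (int (Suc j)) (int p)"
  shows "\<exists>x \<in> {2 * pi * j / p .. 2 * pi * Suc j / p}. poly (fekete p) (cis x) = 0"
proof -
  let ?a = "2 * pi * j / p" and ?b = "2 * pi * Suc j / p"
  define H where "H t = cis (- (real p * t / 2)) * poly (fekete p) (cis t)" for t
  \<comment> \<open>One of the two parts vanishes identically, so \<open>h\<close> is the other one, in both cases.\<close>
  define h where "h t = Re (H t) + Im (H t)" for t
  have "Legendre (- 1) (int p) \<in> {-1, 1}"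
    using Legendre_values[of "- 1" "int p"] Legendre_eq_0_iff[of "- 1" "int p"] p by auto
  then have "cnj (H t) = H t \<or> cnj (H t) = - H t" for t
    using fekete_self_reciprocal[OF p, of t] by (auto simp: H_def)
  then have "Im (H t) = 0 \<or> Re (H t) = 0" for t
    by (auto simp: complex_eq_iff)
  then have "H t = 0" if "h t = 0" for t
    using that by (metis add_0_left add_0_right complex_eqI h_def zero_complex.sel)
  then have h0: "poly (fekete p) (cis t) = 0" if "h t = 0" for t
    using that by (simp add: H_def)
  have "\<not> p dvd j" "\<not> p dvd Suc j"
    using j p by (auto dest: dvd_imp_le)
  then have "H ?b = - H ?a"
  proof -
    have "cis (- (real p * ?b / 2)) = - cis (- (real p * ?a / 2))"
    proof -
      have "- (real p * ?b / 2) = - (real p * ?a / 2) - pi"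
        using p by (simp add: field_simps)
      then show ?thesis
        by (simp add: complex_eq_iff cos_diff sin_diff)
    qed
    moreover have "poly (fekete p) (cis ?b) = poly (fekete p) (cis ?a)"
      using fekete_at_root_of_unity[OF p \<open>\<not> p dvd j\<close>] fekete_at_root_of_unity[OF p \<open>\<not> p dvd Suc j\<close>] eq
      by simp
    ultimately show ?thesis
      by (simp add: H_def)
  qed
  then have hb: "h ?b = - h ?a"
    by (simp add: h_def)
  have "?a \<le> ?b"
    using p by (simp add: divide_right_mono)
  have cont: "continuous_on {?a..?b} h"
    unfolding h_def H_def by (intro continuous_intros) simp_all
  have "\<exists>x. ?a \<le> x \<and> x \<le> ?b \<and> h x = 0"
  proof (cases "h ?a \<le> 0")
    case True
    then show ?thesis
      using hb \<open>?a \<le> ?b\<close> cont by (intro IVT') auto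
  next
    case False
    then show ?thesis
      using hb \<open>?a \<le> ?b\<close> cont by (intro IVT2') auto
  qed
  then show ?thesis
    using h0 by (meson atLeastAtMost_iff)
qed

text \<open>If \<open>\<chi>(j) \<noteq> \<chi>(j+1)\<close>, then \<open>\<chi>(2j) \<noteq> \<chi>(2j+2)\<close> by multiplicativity, so \<open>\<chi>(2j+1)\<close> equals one of
  these two values. Hence each \<open>j \<le> (p-3)/2\<close> accounts for an equal pair at \<open>j\<close>, at \<open>2j\<close> or at
  \<open>2j+1\<close>, and each equal pair is used at most twice. This avoids evaluating the sum of
  \<open>\<chi>(j) \<chi>(j+1)\<close>.\<close>

theorem card_equal_consecutive_Legendre:
  assumes p: "prime p" "2 < p"
  shows "p - 3 \<le> 4 * card {j \<in> {1..p - 2}. Legendre (int j) (int p) = Legendre (int (Suc j)) (int p)}"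
proof -
  let ?L = "\<lambda>k. Legendre (int k) (int p)"
  define E where "E = {j \<in> {1..p - 2}. ?L j = ?L (Suc j)}"
  define A where "A = {1..(p - 3) div 2}"
  have finE: "finite E"
    by (simp add: E_def)
  have alt: "2 * j \<in> E \<or> 2 * j + 1 \<in> E" if j: "j \<in> A" "j \<notin> E" for j
  proof (rule ccontr)
    assume "\<not> ?thesis"
    moreover have r: "1 \<le> j" "j \<le> p - 2" "2 * j + 1 \<le> p - 2"
      using j by (auto simp: A_def)
    ultimately have ne: "?L j \<noteq> ?L (Suc j)" "?L (2 * j) \<noteq> ?L (2 * j + 1)" "?L (2 * j + 1) \<noteq> ?L (2 * j + 2)"
      using j by (auto simp: E_def)
    have nz: "?L k \<noteq> 0" if "1 \<le> k" "k < p" for k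
      using that by (auto simp: Legendre_eq_0_iff dest: dvd_imp_le)
    have "?L (2 * j) = ?L (2 * j + 2)"
      using ne nz[of "2 * j"] nz[of "2 * j + 1"] nz[of "2 * j + 2"] r p
        Legendre_values[of "int (2 * j)" "int p"] Legendre_values[of "int (2 * j + 1)" "int p"]
        Legendre_values[of "int (2 * j + 2)" "int p"] by auto
    moreover have "?L (2 * k) = Legendre 2 (int p) * ?L k" for k
      using Legendre_mult[OF p, of 2 "int k"] by simp
    from this[of j] this[of "Suc j"] have "?L (2 * j) = Legendre 2 (int p) * ?L j"
      "?L (2 * j + 2) = Legendre 2 (int p) * ?L (Suc j)"
      by simp_all
    moreover have "Legendre 2 (int p) \<noteq> 0"
      using nz[of 2] p by simp
    ultimately show False
      using ne by simp
  qed
  define g where "g j = (if 2 * j \<in> E then 2 * j else 2 * j + 1)" for j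
  have "inj_on g (A - E)"
  proof (rule inj_on_inverseI)
    show "g j div 2 = j" for j
      by (simp add: g_def)
  qed
  moreover have "g ` (A - E) \<subseteq> E"
    using alt by (auto simp: g_def)
  ultimately have "card (A - E) \<le> card E"
    using finE by (rule card_inj_on_le)
  moreover have "card (A \<inter> E) \<le> card E"
    using finE by (intro card_mono) auto
  moreover have "card A = card (A \<inter> E) + card (A - E)"
    by (rule card_Int_Diff) (simp add: A_def)
  moreover have "p - 3 \<le> 2 * card A"
  proof -
    have "odd p"
      using p prime_odd_nat by auto
    then have "even (p - 3)"
      using p by auto
    then show ?thesis
      by (simp add: A_def)
  qed
  ultimately show ?thesis
    unfolding E_def by linarith
qed

section \<open>Fekete polynomials are not flat\<close>

lemma
  assumes p: "prime p" "2 < p"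
  shows integral_normalized_fekete: "(\<integral>z. (norm (poly (normalized_fekete p) z))\<^sup>2 \<partial>circle_measure) = 1"
    and normalized_fekete_eq_0_iff: "poly (normalized_fekete p) z = 0 \<longleftrightarrow> poly (fekete p) z = 0"
    and degree_normalized_fekete: "Polynomial.degree (normalized_fekete p) \<le> p"
proof -
  define I where "I = (\<integral>z. (norm (poly (fekete p) z))\<^sup>2 \<partial>circle_measure)"
  define c where "c = 1 / L_norm 2 (poly (fekete p))"
  have q: "normalized_fekete p = Polynomial.smult (complex_of_real c) (fekete p)"
    by (simp add: normalized_fekete_def c_def)
  have "Legendre 1 (int p) \<noteq> 0"
    using p by (simp add: Legendre_eq_0_iff)
  then have "Polynomial.coeff (fekete p) 1 \<noteq> 0"
    using p by (simp add: coeff_fekete)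
  then have "0 < (norm (Polynomial.coeff (fekete p) 1))\<^sup>2" "1 \<le> Polynomial.degree (fekete p)"
    by (simp, rule le_degree)
  moreover from this(2) have "(norm (Polynomial.coeff (fekete p) 1))\<^sup>2 \<le> I"
    unfolding I_def Parseval_poly by (intro member_le_sum) auto
  ultimately have I: "0 < I"
    by linarith
  have "L_norm 2 (poly (fekete p)) = sqrt I"
    unfolding L_norm_def I_def by (simp add: powr_half_sqrt)
  then have c: "c = 1 / sqrt I"
    by (simp add: c_def)
  show "poly (normalized_fekete p) z = 0 \<longleftrightarrow> poly (fekete p) z = 0"
    using I by (simp add: q c)
  show "Polynomial.degree (normalized_fekete p) \<le> p"
    using degree_fekete[of p] degree_smult_le[of "complex_of_real c" "fekete p"] by (simp add: q)
  have "(\<integral>z. (norm (poly (normalized_fekete p) z))\<^sup>2 \<partial>circle_measure) = c\<^sup>2 * I"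
    unfolding I_def q by (simp add: norm_mult power_mult_distrib)
  also have "\<dots> = 1"
    using I by (simp add: c power_divide)
  finally show "(\<integral>z. (norm (poly (normalized_fekete p) z))\<^sup>2 \<partial>circle_measure) = 1" .
qed

text \<open>The number of arcs with a zero is at least \<open>(p-3)/4\<close>, which is at least \<open>p/5\<close> as soon as
  \<open>p \<ge> 15\<close>.\<close>

lemma normalized_fekete_small_values:
  assumes p: "prime p" "15 \<le> p"
  shows "(1 / (40 * pi))\<^sup>2 \<le> measure circle_measure {z. norm (poly (normalized_fekete p) z) \<le> 1 / 2}"
proof -
  have p2: "2 < p"
    using p by simp
  let ?J = "{j \<in> {1..p - 2}. Legendre (int j) (int p) = Legendre (int (Suc j)) (int p)}"
  have "(1 / 5 / (8 * pi))\<^sup>2 \<le> measure circle_measure {z. norm (poly (normalized_fekete p) z) \<le> 1 / 2}"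
  proof (rule measure_small_values[where n = p and J = ?J])
    show "\<exists>x \<in> {2 * pi * j / p .. 2 * pi * Suc j / p}. poly (normalized_fekete p) (cis x) = 0" if "j \<in> ?J" for j
      using fekete_zero_between[OF p(1) p2, of j] that
      by (simp add: normalized_fekete_eq_0_iff[OF p(1) p2])
    have "real (p - 3) \<le> real (4 * card ?J)"
      using card_equal_consecutive_Legendre[OF p(1) p2] by (simp only: of_nat_le_iff)
    then show "1 / 5 * real p \<le> card ?J"
      using p by (simp add: of_nat_diff)
  qed (use integral_normalized_fekete[OF p(1) p2] degree_normalized_fekete[OF p(1) p2] p2 in auto)
  then show ?thesis
    by simp
qed

lemma along_odd_primes_neq_bot: "along_odd_primes \<noteq> bot"
proof
  assume "along_odd_primes = bot"
  then have "\<forall>\<^sub>F p in at_top. \<not> (prime p \<and> odd (p :: nat))"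
    unfolding along_odd_primes_def by (simp add: trivial_limit_def eventually_inf_principal)
  then obtain N :: nat where N: "\<And>p. N \<le> p \<Longrightarrow> \<not> (prime p \<and> odd p)"
    by (auto simp: eventually_at_top_linorder)
  obtain p where "prime p" "N + 2 < p"
    using bigger_prime by blast
  then show False
    using N[of p] prime_odd_nat by auto
qed

theorem theoremA2:
  fixes \<alpha> :: real
  assumes "0 \<le> \<alpha>"
  shows "\<not> L_flat \<alpha> along_odd_primes normalized_fekete"
proof (rule not_L_flat_if_small_values[OF assms along_odd_primes_neq_bot])
  show "0 < (1 / (40 * pi))\<^sup>2"
    by simp
  have "\<forall>\<^sub>F p in at_top. (15::nat) \<le> p"
    by (rule eventually_ge_at_top)
  then have "\<forall>\<^sub>F p in along_odd_primes. 15 \<le> p \<and> prime p"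
    unfolding along_odd_primes_def eventually_inf_principal by eventually_elim simp
  then show "\<forall>\<^sub>F p in along_odd_primes.
      (\<integral>z. (norm (poly (normalized_fekete p) z))\<^sup>2 \<partial>circle_measure) = 1
      \<and> (1 / (40 * pi))\<^sup>2 \<le> measure circle_measure {z. norm (poly (normalized_fekete p) z) \<le> 1 / 2}"
  proof eventually_elim
    case (elim p)
    then show ?case
      using integral_normalized_fekete[of p] normalized_fekete_small_values[of p] by simp
  qed
qed

end
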